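(* Let $\eta\in[0,2\pi)$ and let $G=(V,\mathcal{A})$ be a mixed cycle on $n\ge3$ vertices equipped with its $\eta$-function $\theta$. Then $G$ is periodic if and only if $\eta\in\mathbb{Q}\pi$. Moreover, suppose $\eta\in\mathbb{Q}\pi$ and $G$ is $H_\eta$-cospectral with $C_n^j$ (for some $j\in\{0,\dots,n\}$), and write $\eta=\frac{p}{q}\pi$ with $p\ge 0$, $q\ge1$ integers, $p,q$ coprime. Then the period $\tau$ of $G$ is \[ \tau = \begin{cases} \dfrac{2qn}{(j,2q)} & \text{if } p \text{ is odd},\\[2mm] \dfrac{qn}{(j,q)} & \text{if } p \text{ is even},\end{cases} \] where $(m_1,m_2)$ denotes the greatest common divisor, with the convention $(0,m)=m$.
   Context: A mixed graph $G=(V,\mathcal{A})$ consists of a finite vertex set $V$ and arcs $\mathcal{A}\subseteq (V\times V)\setminus\{(x,x)\}$; $\mathcal{A}^{-1}=\{(y,x):(x,y)\in\mathcal{A}\}$, $\mathcal{A}^{\pm}=\mathcal{A}\cup\mathcal{A}^{-1}$. The underlying graph $G^{\pm}$ is the simple undirected graph on $V$ with $x\sim y$ iff $(x,y)\in\mathcal{A}^{\pm}$; a mixed cycle is a mixed graph whose underlying graph is a cycle. $\deg x$ is the degree in $G^{\pm}$. For $a=(x,y)$: $o(a)=x$, $t(a)=y$, $a^{-1}=(y,x)$. The $\eta$-Hermitian adjacency matrix $H_\eta(G)\in\mathbb{C}^{V\times V}$ has $(x,y)$-entry $1$ if $(x,y)\in\mathcal{A}\cap\mathcal{A}^{-1}$,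 $e^{\eta i}$ if $(x,y)\in\mathcal{A}\setminus\mathcal{A}^{-1}$, $e^{-\eta i}$ if $(x,y)\in\mathcal{A}^{-1}\setminus\mathcal{A}$, $0$ otherwise; two mixed graphs are $H_\eta$-cospectral if these matrices have the same spectrum with multiplicities. $C_n^j$ is the mixed cycle with vertices $x_1,\dots,x_n$ ($x_{n+1}=x_1$) and arcs $\{(x_i,x_{i+1}):1\le i\le j\}\cup\{(x_i,x_{i+1}),(x_{i+1},x_i): j+1\le i\le n\}$. The $\eta$-function is $\theta(a)=\eta$ if $a\in\mathcal{A}\setminus\mathcal{A}^{-1}$, $-\eta$ if $a\in\mathcal{A}^{-1}\setminus\mathcal{A}$, $0$ if $a\in\mathcal{A}\cap\mathcal{A}^{-1}$. Define $K\in\mathbb{C}^{V\times\mathcal{A}^{\pm}}$, $K_{x,a}=\delta_{x,t(a)}/\sqrt{\deg x}$; $C=2K^*K-I$; $(S_\theta)_{a,b}=e^{\theta(b)i}\delta_{a,b^{-1}}$; $U_\theta=S_\theta C$. $G$ is periodic if $U_\theta^\tau=I$ for some $\tau\in\mathbb{N}$, and the period is the least such $\tau$.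
   Formalization: "Periodic only if η∈ℚπ" is asserted only for G not H_η-cospectral with C_n^0, since e.g. the undirected cycle has U^n = I for every η; "η∈ℚπ implies periodic" and the period formula are kept without restriction. *)

theory Defs
  imports
    "Graph_Theory.Digraph_Component"
    "Jordan_Normal_Form.Schur_Decomposition"
    "HOL-Library.Countable_Set"
begin

text \<open>
  A mixed graph is a finite loop-free digraph without parallel arcs, i.e. an instance of
  the locale \<^locale>\<open>pair_digraph\<close>.  Its arc set is \<^const>\<open>parcs\<close>, and the arcs of
  \<^const>\<open>mk_symmetric\<close> are the symmetric closure of the arc set.
\<close>

abbreviation sym_arcs :: "'a pair_pre_digraph \<Rightarrow> ('a \<times> 'a) set" where
  "sym_arcs G \<equiv> parcs (mk_symmetric G)"

abbreviation arc_inv :: "'a \<times> 'a \<Rightarrow> 'a \<times> 'a" where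
  "arc_inv \<equiv> prod.swap"

text \<open>The out-degree in the symmetric closure is the degree in the underlying simple graph.\<close>

definition mixed_degree :: "'a pair_pre_digraph \<Rightarrow> 'a \<Rightarrow> nat" where
  "mixed_degree G x = out_degree (mk_symmetric G) x"

definition mixed_cycle :: "'a pair_pre_digraph \<Rightarrow> bool" where
  "mixed_cycle G \<longleftrightarrow> pair_digraph G \<and> 3 \<le> card (pverts G) \<and>
     (\<exists>x. bij_betw x {..<card (pverts G)} (pverts G) \<and>
       sym_arcs G = (\<Union>i<card (pverts G).
         {(x i, x (Suc i mod card (pverts G))), (x (Suc i mod card (pverts G)), x i)}))"

text \<open>The vertices \<open>x\<^sub>1, \<dots>, x\<^sub>n\<close> are the numbers \<open>1, \<dots>, n\<close>.\<close>

definition cyc_next :: "nat \<Rightarrow> nat \<Rightarrow> nat" where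
  "cyc_next n i = (if i = n then 1 else i + 1)"

definition std_mixed_cycle :: "nat \<Rightarrow> nat \<Rightarrow> nat pair_pre_digraph" where
  "std_mixed_cycle n j = \<lparr> pverts = {1..n},
     parcs = (\<Union>i\<in>{1..j}. {(i, cyc_next n i)}) \<union>
             (\<Union>i\<in>{j+1..n}. {(i, cyc_next n i), (cyc_next n i, i)}) \<rparr>"

text \<open>
  Matrices indexed by finite sets: \<^term>\<open>from_nat_into I\<close> is a bijection from
  \<open>{..<card I}\<close> onto a finite set \<open>I\<close>.  Another choice of enumeration
  only conjugates square matrices by a permutation matrix, which affects neither spectra nor
  whether a power is the identity.
\<close>

definition mat_on :: "'i set \<Rightarrow> 'j set \<Rightarrow> ('i \<Rightarrow> 'j \<Rightarrow> complex) \<Rightarrow> complex mat" where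
  "mat_on I J f =
     mat (card I) (card J) (\<lambda>(k, l). f (from_nat_into I k) (from_nat_into J l))"

definition H_mat :: "real \<Rightarrow> 'a pair_pre_digraph \<Rightarrow> complex mat" where
  "H_mat \<eta> G = mat_on (pverts G) (pverts G) (\<lambda>x y.
     if (x, y) \<in> parcs G \<inter> (parcs G)\<inverse> then 1
     else if (x, y) \<in> parcs G - (parcs G)\<inverse> then exp (\<i> * complex_of_real \<eta>)
     else if (x, y) \<in> (parcs G)\<inverse> - parcs G then exp (- (\<i> * complex_of_real \<eta>))
     else 0)"

text \<open>The spectrum with (algebraic) multiplicities.\<close>

definition mat_spectrum :: "complex mat \<Rightarrow> complex multiset" where
  "mat_spectrum M = proots (char_poly M)"

definition H_cospectral :: "real \<Rightarrow> 'a pair_pre_digraph \<Rightarrow> 'b pair_pre_digraph \<Rightarrow> bool" where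
  "H_cospectral \<eta> G G' \<longleftrightarrow> mat_spectrum (H_mat \<eta> G) = mat_spectrum (H_mat \<eta> G')"

text \<open>Only the values on \<^term>\<open>sym_arcs G\<close> matter.\<close>

definition eta_fun :: "real \<Rightarrow> 'a pair_pre_digraph \<Rightarrow> 'a \<times> 'a \<Rightarrow> real" where
  "eta_fun \<eta> G a =
     (if a \<in> parcs G - (parcs G)\<inverse> then \<eta>
      else if a \<in> (parcs G)\<inverse> - parcs G then - \<eta>
      else 0)"

definition K_mat :: "'a pair_pre_digraph \<Rightarrow> complex mat" where
  "K_mat G = mat_on (pverts G) (sym_arcs G) (\<lambda>x a.
     if x = snd a then 1 / complex_of_real (sqrt (real (mixed_degree G x))) else 0)"

definition C_mat :: "'a pair_pre_digraph \<Rightarrow> complex mat" where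
  "C_mat G = 2 \<cdot>\<^sub>m (mat_adjoint (K_mat G) * K_mat G) - 1\<^sub>m (card (sym_arcs G))"

definition S_mat :: "'a pair_pre_digraph \<Rightarrow> ('a \<times> 'a \<Rightarrow> real) \<Rightarrow> complex mat" where
  "S_mat G \<theta> = mat_on (sym_arcs G) (sym_arcs G) (\<lambda>a b.
     if a = arc_inv b then exp (\<i> * complex_of_real (\<theta> b)) else 0)"

definition U_mat :: "'a pair_pre_digraph \<Rightarrow> ('a \<times> 'a \<Rightarrow> real) \<Rightarrow> complex mat" where
  "U_mat G \<theta> = S_mat G \<theta> * C_mat G"

text \<open>Here \<open>\<tau>\<close> ranges over the positive integers.\<close>

definition is_return_time ::
    "'a pair_pre_digraph \<Rightarrow> ('a \<times> 'a \<Rightarrow> real) \<Rightarrow> nat \<Rightarrow> bool" where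
  "is_return_time G \<theta> \<tau> \<longleftrightarrow> 0 < \<tau> \<and> U_mat G \<theta> ^\<^sub>m \<tau> = 1\<^sub>m (card (sym_arcs G))"

definition qw_periodic :: "'a pair_pre_digraph \<Rightarrow> ('a \<times> 'a \<Rightarrow> real) \<Rightarrow> bool" where
  "qw_periodic G \<theta> \<longleftrightarrow> (\<exists>\<tau>. is_return_time G \<theta> \<tau>)"

definition qw_period :: "'a pair_pre_digraph \<Rightarrow> ('a \<times> 'a \<Rightarrow> real) \<Rightarrow> nat" where
  "qw_period G \<theta> = (LEAST \<tau>. is_return_time G \<theta> \<tau>)"

definition rat_mult_pi :: "real set" where
  "rat_mult_pi = {r * pi | r. r \<in> \<rat>}"

end

theory Submission
  imports Defs
begin

text \<open>
  On a cycle every vertex has degree \<open>2\<close>, so the Grover coin merely exchanges the two arcs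
  entering a vertex. Hence the walk matrix is monomial: it moves along the two orientations of the
  cycle, and \<open>n\<close> steps multiply by \<open>cis (- \<alpha>)\<close> on one orientation and by \<open>cis \<alpha>\<close> on the other,
  where \<open>\<alpha>\<close> is the sum of the \<open>\<eta>\<close>-function along the cycle, an integer multiple of \<open>\<eta>\<close>. So the return
  times are the multiples \<open>n * r\<close> with \<open>cis (r * \<alpha>) = 1\<close>.

  After a diagonal gauge transformation the eigenvalue equation of the Hermitian adjacency matrix
  becomes \<open>Z (k + 2) + Z k = \<mu> * Z (k + 1)\<close> with \<open>Z (k + n) = cis \<alpha> * Z k\<close>. Its solutions show that
  \<open>2 * cos (\<alpha> / n)\<close> is an eigenvalue, and that a common eigenvalue with \<open>C\<^sub>n\<^sup>j\<close>, whose phase is \<open>j * \<eta>\<close>,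
  forces \<open>cis (j * \<eta>) = cis (\<plusminus>\<alpha>)\<close>. Hence \<open>\<alpha>\<close> may be replaced by \<open>j * \<eta>\<close> in the description of the return
  times.
\<close>

section \<open>Matrices indexed by finite sets\<close>

lemma mat_on_carrier [simp]: "mat_on I J f \<in> carrier_mat (card I) (card J)"
  by (simp add: mat_on_def)

lemma dim_mat_on [simp]: "dim_row (mat_on I J f) = card I" "dim_col (mat_on I J f) = card J"
  by (simp_all add: mat_on_def)

lemma from_nat_into_mem_finite: "k < card I \<Longrightarrow> from_nat_into I k \<in> I"
  by (metis card.empty from_nat_into not_less_zero)

lemma from_nat_into_eq_iff_finite:
  assumes "finite I" "k < card I" "l < card I"
  shows "from_nat_into I k = from_nat_into I l \<longleftrightarrow> k = l"
  using bij_betw_from_nat_into_finite[OF assms(1)] assms(2,3)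
  by (auto simp: bij_betw_def inj_on_def)

lemma mat_on_eq_iff:
  assumes "finite I" "finite J"
  shows "mat_on I J f = mat_on I J g \<longleftrightarrow> (\<forall>x\<in>I. \<forall>y\<in>J. f x y = g x y)"
proof
  assume eq: "mat_on I J f = mat_on I J g"
  show "\<forall>x\<in>I. \<forall>y\<in>J. f x y = g x y"
  proof (intro ballI)
    fix x y assume "x \<in> I" "y \<in> J"
    then obtain k l where k: "k < card I" "x = from_nat_into I k"
      and l: "l < card J" "y = from_nat_into J l"
      using bij_betw_from_nat_into_finite[OF assms(1)] bij_betw_from_nat_into_finite[OF assms(2)]
      unfolding bij_betw_def by (metis imageE lessThan_iff)
    have "mat_on I J f $$ (k, l) = mat_on I J g $$ (k, l)" by (simp add: eq)
    then show "f x y = g x y" using k l by (simp add: mat_on_def)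
  qed
next
  assume "\<forall>x\<in>I. \<forall>y\<in>J. f x y = g x y"
  then show "mat_on I J f = mat_on I J g"
    by (auto simp: mat_on_def from_nat_into_mem_finite)
qed

lemma mat_on_cong:
  assumes "\<And>x y. x \<in> I \<Longrightarrow> y \<in> J \<Longrightarrow> f x y = g x y"
  shows "mat_on I J f = mat_on I J g"
  using assms by (auto simp: mat_on_def from_nat_into_mem_finite)

lemma mat_on_mult:
  "mat_on I J f * mat_on J L g = mat_on I L (\<lambda>x z. \<Sum>y\<in>J. f x y * g y z)"
  by (rule eq_matI)
     (auto simp: mat_on_def scalar_prod_def atLeast0LessThan sum.card_from_nat_into
        intro!: sum.card_from_nat_into[where h="\<lambda>y. f _ y * g y _"])

lemma one_mat_on: "finite I \<Longrightarrow> 1\<^sub>m (card I) = mat_on I I (\<lambda>x y. if x = y then 1 else 0)"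
  by (rule eq_matI) (auto simp: mat_on_def from_nat_into_eq_iff_finite)

lemma smult_mat_on: "c \<cdot>\<^sub>m mat_on I J f = mat_on I J (\<lambda>x y. c * f x y)"
  by (rule eq_matI) (auto simp: mat_on_def)

lemma minus_mat_on: "mat_on I J f - mat_on I J g = mat_on I J (\<lambda>x y. f x y - g x y)"
  by (rule eq_matI) (auto simp: mat_on_def)

lemma adjoint_mat_on: "mat_adjoint (mat_on I J f) = mat_on J I (\<lambda>x y. cnj (f y x))"
  by (rule eq_matI) (auto simp: mat_on_def mat_adjoint_def mat_of_rows_def)

text \<open>Each row has at most one nonzero entry, so the sum in a product collapses: powers follow
  the orbit of \<open>g\<close> and collect the weights met on the way.\<close>

lemma mat_on_monomial_pow:
  fixes c :: "'i \<Rightarrow> complex"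
  assumes I: "finite I" and g: "\<And>a. a \<in> I \<Longrightarrow> g a \<in> I"
  shows "mat_on I I (\<lambda>a b. if b = g a then c a else 0) ^\<^sub>m t =
    mat_on I I (\<lambda>a b. if b = (g ^^ t) a then \<Prod>s<t. c ((g ^^ s) a) else 0)"
proof (induction t)
  case 0
  then show ?case by (auto simp: one_mat_on[OF I] intro!: mat_on_cong)
next
  case (Suc t)
  have mem: "(g ^^ s) a \<in> I" if "a \<in> I" for a s
    using that g by (induction s) auto
  have "(\<Sum>y\<in>I. (if y = (g ^^ t) x then \<Prod>s<t. c ((g ^^ s) x) else 0) *
          (if z = g y then c y else 0)) =
        (if z = (g ^^ Suc t) x then \<Prod>s<Suc t. c ((g ^^ s) x) else 0)"
    if "x \<in> I" for x z
  proof -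
    have "(\<Sum>y\<in>I. (if y = (g ^^ t) x then \<Prod>s<t. c ((g ^^ s) x) else 0) *
          (if z = g y then c y else 0)) =
        (\<Sum>y\<in>I. if y = (g ^^ t) x then (\<Prod>s<t. c ((g ^^ s) x)) *
          (if z = g y then c y else 0) else 0)"
      by (rule sum.cong) auto
    also have "\<dots> = (\<Prod>s<t. c ((g ^^ s) x)) * (if z = g ((g ^^ t) x) then c ((g ^^ t) x) else 0)"
      using I mem[OF that] by (simp add: sum.delta')
    finally show ?thesis by simp
  qed
  then show ?case
    by (simp add: Suc mat_on_mult del: funpow.simps cong: mat_on_cong)
qed

lemma eigenvalue_mat_on:
  assumes I: "finite I"
  shows "eigenvalue (mat_on I I h) k \<longleftrightarrow>
    (\<exists>v. (\<exists>x\<in>I. v x \<noteq> 0) \<and> (\<forall>x\<in>I. (\<Sum>y\<in>I. h x y * v y) = k * v x))"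
proof -
  have bij: "bij_betw (from_nat_into I) {..<card I} I"
    by (rule bij_betw_from_nat_into_finite[OF I])
  have vec_of: "eigenvector (mat_on I I h) (vec (card I) (\<lambda>i. v (from_nat_into I i))) k \<longleftrightarrow>
    ((\<exists>x\<in>I. v x \<noteq> 0) \<and> (\<forall>x\<in>I. (\<Sum>y\<in>I. h x y * v y) = k * v x))" for v
  proof -
    have mv: "mat_on I I h *\<^sub>v vec (card I) (\<lambda>i. v (from_nat_into I i)) =
      vec (card I) (\<lambda>i. \<Sum>y\<in>I. h (from_nat_into I i) y * v y)"
      by (rule eq_vecI)
         (auto simp: mat_on_def scalar_prod_def atLeast0LessThan
           intro!: sum.card_from_nat_into[where h="\<lambda>y. h _ y * v y"])
    have all: "(\<forall>i<card I. P (from_nat_into I i)) \<longleftrightarrow> (\<forall>x\<in>I. P x)" for P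
      using bij unfolding bij_betw_def by (metis imageE imageI lessThan_iff)
    have "vec (card I) (\<lambda>i. v (from_nat_into I i)) = 0\<^sub>v (card I) \<longleftrightarrow> (\<forall>x\<in>I. v x = 0)"
      using all[of "\<lambda>x. v x = 0"] by (simp add: vec_eq_iff)
    moreover have "vec (card I) (\<lambda>i. \<Sum>y\<in>I. h (from_nat_into I i) y * v y) =
        k \<cdot>\<^sub>v vec (card I) (\<lambda>i. v (from_nat_into I i)) \<longleftrightarrow>
      (\<forall>x\<in>I. (\<Sum>y\<in>I. h x y * v y) = k * v x)"
      using all[of "\<lambda>x. (\<Sum>y\<in>I. h x y * v y) = k * v x"] by (simp add: vec_eq_iff)
    ultimately show ?thesis
      unfolding eigenvector_def mv by simp
  qed
  show ?thesis
  proof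
    assume "eigenvalue (mat_on I I h) k"
    then obtain w where w: "eigenvector (mat_on I I h) w k"
      by (auto simp: eigenvalue_def)
    define v where "v = (\<lambda>x. w $ inv_into {..<card I} (from_nat_into I) x)"
    have "w = vec (card I) (\<lambda>i. v (from_nat_into I i))"
      using w bij
      by (intro eq_vecI) (auto simp: v_def eigenvector_def bij_betw_inv_into_left)
    then show "\<exists>v. (\<exists>x\<in>I. v x \<noteq> 0) \<and> (\<forall>x\<in>I. (\<Sum>y\<in>I. h x y * v y) = k * v x)"
      using w vec_of[of v] by blast
  next
    assume "\<exists>v. (\<exists>x\<in>I. v x \<noteq> 0) \<and> (\<forall>x\<in>I. (\<Sum>y\<in>I. h x y * v y) = k * v x)"
    then show "eigenvalue (mat_on I I h) k"
      unfolding eigenvalue_def vec_of[symmetric] by blast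
  qed
qed

section \<open>Sums of periodic sequences and roots of unity\<close>

lemma sum_lessThan_add:
  fixes g :: "nat \<Rightarrow> 'a::comm_monoid_add"
  shows "(\<Sum>s<a + b. g s) = (\<Sum>s<a. g s) + (\<Sum>s<b. g (a + s))"
  by (induction b) (simp_all add: add.assoc)

text \<open>Moving the window by one drops \<open>w k\<close> and gains \<open>w (k + n)\<close>,
  which are equal.\<close>

lemma sum_periodic_shift:
  fixes w :: "nat \<Rightarrow> 'a::ab_group_add"
  assumes "\<And>k. w (k + n) = w k"
  shows "(\<Sum>s<n. w (k + s)) = (\<Sum>s<n. w s)"
proof (induction k)
  case (Suc k)
  have "w k + (\<Sum>s<n. w (Suc k + s)) = (\<Sum>s<Suc n. w (k + s))"
    by (subst sum.lessThan_Suc_shift) simp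
  also have "\<dots> = (\<Sum>s<n. w (k + s)) + w k"
    by (simp add: assms)
  finally show ?case using Suc by (simp add: algebra_simps)
qed simp

lemma sum_periodic_mult:
  fixes w :: "nat \<Rightarrow> real"
  assumes "\<And>k. w (k + n) = w k"
  shows "(\<Sum>s<n * r. w (k + s)) = real r * (\<Sum>s<n. w s)"
proof (induction r)
  case (Suc r)
  have "(\<Sum>s<n * Suc r. w (k + s)) = (\<Sum>s<n * r + n. w (k + s))"
    by (simp add: add.commute)
  also have "\<dots> = (\<Sum>s<n * r. w (k + s)) + (\<Sum>s<n. w ((k + n * r) + s))"
    by (simp only: sum_lessThan_add add.assoc)
  finally show ?case
    unfolding Suc sum_periodic_shift[of w n, OF assms] by (simp add: algebra_simps)
qed simp

lemma prod_cis: "(\<Prod>s<(t::nat). cis (g s)) = cis (\<Sum>s<t. g s)"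
  by (induction t) (simp_all add: cis_mult)

lemma cis_minus_eq_1_iff: "cis (- x) = 1 \<longleftrightarrow> cis x = 1"
  by (metis cis_cnj complex_cnj_cnj complex_cnj_one)

lemma cis_eq_1_iff: "cis x = 1 \<longleftrightarrow> (\<exists>N::int. x = of_int N * (2 * pi))"
proof -
  have "cis x = 1 \<longleftrightarrow> cos x = 1"
    by (auto simp: complex_eq_iff) (metis cos_one_sin_zero)
  then show ?thesis by (simp add: cos_one_2pi_int mult.assoc)
qed

section \<open>The walk matrix of a labelled cycle\<close>

lemma sym_arcs_eq: "sym_arcs G = parcs G \<union> (parcs G)\<inverse>"
  by (auto simp: parcs_mk_symmetric)

lemma eta_fun_swap: "eta_fun \<eta> G (prod.swap a) = - eta_fun \<eta> G a"
  by (cases a) (auto simp: eta_fun_def)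

text \<open>Digons have \<eta>-value 0 and reversed arcs the opposite value, so the case distinction
  becomes a single phase on the edges of the underlying graph.\<close>

lemma H_mat_eq:
  "H_mat \<eta> G = mat_on (pverts G) (pverts G)
     (\<lambda>x z. if (x, z) \<in> sym_arcs G then cis (eta_fun \<eta> G (x, z)) else 0)"
  unfolding H_mat_def sym_arcs_eq
  by (rule mat_on_cong) (auto simp: eta_fun_def cis_conv_exp)

text \<open>Labels run over all natural numbers and count modulo \<open>n\<close>. Going round the
  cycle is then plain \<open>Suc\<close>, with no wrap-around case.\<close>

locale labelled_cycle =
  fixes G :: "'a pair_pre_digraph" and n :: nat and y :: "nat \<Rightarrow> 'a"
  assumes n3: "3 \<le> n"
    and y_eq: "y k = y l \<longleftrightarrow> k mod n = l mod n"
    and verts: "pverts G = range y"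
    and arcs: "sym_arcs G = range (\<lambda>k. (y k, y (Suc k))) \<union> range (\<lambda>k. (y (Suc k), y k))"
begin

abbreviation arc :: "nat \<Rightarrow> 'a \<times> 'a" where "arc k \<equiv> (y k, y (Suc k))"

lemma y_add [simp]: "y (k + n) = y k"
  by (simp add: y_eq)

lemma y_Suc_add [simp]: "y (Suc (k + n)) = y (Suc k)"
  using y_add[of "Suc k"] by simp

lemma y_Suc_eq [simp]: "y (Suc k) = y (Suc l) \<longleftrightarrow> y k = y l"
  using n3 by (auto simp: y_eq mod_Suc)

lemma y_Suc_neq [simp]: "y (Suc k) \<noteq> y k" "y k \<noteq> y (Suc k)"
  using n3 by (auto simp: y_eq mod_Suc)

text \<open>The two neighbours of a vertex are distinct; this is where length 2 has to be
  excluded.\<close>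

lemma y_Suc_Suc_neq [simp]: "y (Suc (Suc k)) \<noteq> y k" "y k \<noteq> y (Suc (Suc k))"
  using n3 by (auto simp: y_eq mod_Suc split: if_splits)

text \<open>Natural numbers cannot be decreased freely, but adding \<open>n - 1\<close> acts modulo
  \<open>n\<close> as subtracting 1.\<close>

lemma ex_shifted_index: "\<exists>l. y k = y (l + t)"
proof
  have "k + t * (n - 1) + t = k + t * n"
    using n3 by (cases n) auto
  then show "y k = y (k + t * (n - 1) + t)"
    by (simp only: y_eq mod_mult_self1)
qed

lemma vertE:
  assumes "x \<in> pverts G" obtains k where "x = y (k + t)"
  using assms ex_shifted_index[of _ t] unfolding verts by blast

lemma vert_SucE:
  assumes "x \<in> pverts G" obtains k where "x = y (Suc k)"
  using assms by (rule vertE[where t=1]) auto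

lemma y_mem [simp]: "y k \<in> pverts G"
  by (simp add: verts)

lemma arc_mem [simp]: "arc k \<in> sym_arcs G" "prod.swap (arc k) \<in> sym_arcs G" "(y (Suc k), y k) \<in> sym_arcs G"
  by (auto simp: arcs)

text \<open>Stepping back along the walk lowers the index of a forward arc and raises that of a
  reversed one. The shift therefore leaves room for \<open>t\<close> steps in the forward case
  only.\<close>

lemma arcE:
  assumes "a \<in> sym_arcs G"
  obtains k where "a = arc (k + t)" | k where "a = prod.swap (arc k)"
proof -
  from assms consider k where "a = arc k" | k where "a = prod.swap (arc k)"
    by (auto simp: arcs)
  then show thesis
  proof cases
    case 1
    obtain l where "y k = y (l + t)" using ex_shifted_index by blast
    then show thesis using 1 that(1)[of l] by simp
  qed (use that in blast)
qed

lemma verts_image: "pverts G = y ` {..<n}"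
proof
  show "pverts G \<subseteq> y ` {..<n}"
  proof
    fix x assume "x \<in> pverts G"
    then obtain k where "x = y k" by (auto simp: verts)
    then have "x = y (k mod n)" by (simp add: y_eq)
    then show "x \<in> y ` {..<n}" using n3 by auto
  qed
qed (auto simp: verts)

lemma inj_y: "inj_on y {..<n}"
  by (auto simp: inj_on_def y_eq)

lemma card_verts: "card (pverts G) = n"
  by (simp add: verts_image card_image[OF inj_y])

lemma finite_verts [simp]: "finite (pverts G)"
  by (simp add: verts_image)

lemma finite_arcs [simp]: "finite (sym_arcs G)"
  by (rule finite_subset[of _ "pverts G \<times> pverts G"])
     (auto simp: arcs intro: finite_cartesian_product)

lemma arc_from_iff:
  "(y (Suc k), z) \<in> sym_arcs G \<longleftrightarrow> z = y k \<or> z = y (Suc (Suc k))"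
proof
  assume "(y (Suc k), z) \<in> sym_arcs G"
  then consider l where "y (Suc k) = y l" "z = y (Suc l)" | l where "y (Suc k) = y (Suc l)" "z = y l"
    unfolding arcs by auto
  then show "z = y k \<or> z = y (Suc (Suc k))"
    by cases (metis y_Suc_eq)+
qed auto

lemma degree_eq_2:
  assumes "x \<in> pverts G" shows "mixed_degree G x = 2"
proof -
  obtain k where x: "x = y (Suc k)" using assms by (rule vert_SucE)
  have "out_arcs (mk_symmetric G) x = Pair x ` {z. (x, z) \<in> sym_arcs G}"
    by (force simp: out_arcs_def)
  also have "{z. (x, z) \<in> sym_arcs G} = {y k, y (Suc (Suc k))}"
    unfolding x arc_from_iff by blast
  finally show ?thesis by (simp add: mixed_degree_def out_degree_def)
qed

text \<open>Exactly two arcs enter \<open>y (Suc k)\<close>, namely \<open>arc k\<close> and the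
  reversal of \<open>arc (Suc k)\<close>; excluding the latter leaves \<open>arc k\<close>.\<close>

lemma before_forward_iff:
  assumes "b \<in> sym_arcs G"
  shows "snd b = fst (arc (Suc k)) \<and> b \<noteq> prod.swap (arc (Suc k)) \<longleftrightarrow> b = arc k"
  using assms
proof (cases rule: arcE[where t=0])
  case (1 l)
  then show ?thesis by (cases "y l = y k") simp_all
next
  case (2 l)
  show ?thesis
  proof (cases "y l = y (Suc k)")
    case True
    then have "y (Suc l) = y (Suc (Suc k))" by (simp only: y_Suc_eq)
    with 2 True show ?thesis by simp
  qed (use 2 in simp)
qed

lemma before_backward_iff:
  assumes "b \<in> sym_arcs G"
  shows "snd b = fst (prod.swap (arc k)) \<and> b \<noteq> arc k \<longleftrightarrow> b = prod.swap (arc (Suc k))"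
  using assms
proof (cases rule: arcE[where t=0])
  case (1 l)
  then show ?thesis by (cases "y l = y k") simp_all
next
  case (2 l)
  show ?thesis
  proof (cases "y l = y (Suc k)")
    case True
    then have "y (Suc l) = y (Suc (Suc k))" by (simp only: y_Suc_eq)
    with 2 True show ?thesis by simp
  qed (use 2 in simp)
qed

text \<open>The arc preceding \<open>a\<close> on a walk without backtracking. The description
  avoids labels, which are determined only modulo \<open>n\<close>.\<close>

definition pred_arc :: "'a \<times> 'a \<Rightarrow> 'a \<times> 'a" where
  "pred_arc a = (THE b. b \<in> sym_arcs G \<and> snd b = fst a \<and> b \<noteq> prod.swap a)"

lemma pred_arc_forward [simp]: "pred_arc (arc (Suc k)) = arc k"
  unfolding pred_arc_def by (rule the_equality) (use before_forward_iff arc_mem in blast)+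

lemma pred_arc_backward [simp]: "pred_arc (y (Suc k), y k) = (y (Suc (Suc k)), y (Suc k))"
proof -
  have "(y (Suc (Suc k)), y (Suc k)) \<in> sym_arcs G" by simp
  then show ?thesis
    unfolding pred_arc_def using before_backward_iff[of _ k] by (intro the_equality) (simp_all, blast)
qed

lemma pred_arc_iff:
  assumes "a \<in> sym_arcs G" "b \<in> sym_arcs G"
  shows "snd b = fst a \<and> b \<noteq> prod.swap a \<longleftrightarrow> b = pred_arc a"
  using assms(1)
proof (cases rule: arcE[where t=1])
  case (1 k)
  then show ?thesis using before_forward_iff[OF assms(2), of k] by simp
next
  case (2 k)
  then show ?thesis using before_backward_iff[OF assms(2), of k] by simp
qed

lemma pred_arc_mem: "a \<in> sym_arcs G \<Longrightarrow> pred_arc a \<in> sym_arcs G"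
  by (erule arcE[where t=1]) auto

lemma pred_arc_pow_forward [simp]: "(pred_arc ^^ t) (arc (k + t)) = arc k"
  by (induction t) (simp_all del: funpow.simps add: funpow_Suc_right)

lemma pred_arc_pow_backward [simp]: "(pred_arc ^^ t) (y (Suc k), y k) = (y (Suc (k + t)), y (k + t))"
  by (induction t) simp_all

text \<open>All degrees are 2, so two arcs with the same head give 1/2 in the Gram matrix of
  \<open>K_mat G\<close>. Doubling and subtracting the identity clears the diagonal and leaves 1 at
  the other arc with that head.\<close>

lemma C_mat_eq:
  "C_mat G = mat_on (sym_arcs G) (sym_arcs G) (\<lambda>c b. if snd c = snd b \<and> c \<noteq> b then 1 else 0)"
proof -
  have "(\<Sum>x\<in>pverts G.
          cnj (if x = snd a then 1 / complex_of_real (sqrt (real (mixed_degree G x))) else 0) *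
          (if x = snd b then 1 / complex_of_real (sqrt (real (mixed_degree G x))) else 0)) =
        (if snd a = snd b then 1 / 2 else 0)" (is "?S = _")
    if "a \<in> sym_arcs G" "b \<in> sym_arcs G" for a b
  proof -
    have mem: "snd a \<in> pverts G" using that(1) by (rule arcE[where t=0]) simp_all
    have sqrt2: "complex_of_real (sqrt 2) * complex_of_real (sqrt 2) = 2"
      by (simp flip: of_real_mult)
    have "?S = (\<Sum>x\<in>pverts G. if x = snd a then (if snd a = snd b then 1 / 2 else 0) else 0)"
    proof (rule sum.cong)
      fix x assume "x \<in> pverts G"
      then show "cnj (if x = snd a then 1 / complex_of_real (sqrt (real (mixed_degree G x))) else 0) *
          (if x = snd b then 1 / complex_of_real (sqrt (real (mixed_degree G x))) else 0) =
          (if x = snd a then (if snd a = snd b then 1 / 2 else 0) else 0)"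
        by (auto simp: degree_eq_2 sqrt2)
    qed simp
    also have "\<dots> = (if snd a = snd b then 1 / 2 else 0)"
      using mem by simp
    finally show ?thesis .
  qed
  then show ?thesis
    unfolding C_mat_def K_mat_def
    by (auto simp: adjoint_mat_on mat_on_mult smult_mat_on one_mat_on minus_mat_on intro!: mat_on_cong)
qed

text \<open>\<open>S_mat\<close> forces the intermediate arc to be the reversal of \<open>a\<close>,
  with phase \<open>- \<theta> a\<close>; \<open>C_mat\<close> then passes to the other arc ending
  at the tail of \<open>a\<close>, which is \<open>pred_arc a\<close>.\<close>

lemma U_mat_eq:
  assumes \<theta>: "\<And>a. \<theta> (prod.swap a) = - \<theta> a"
  shows "U_mat G \<theta> = mat_on (sym_arcs G) (sym_arcs G) (\<lambda>a b. if b = pred_arc a then cis (- \<theta> a) else 0)"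
  unfolding U_mat_def S_mat_def C_mat_eq mat_on_mult
proof (rule mat_on_cong)
  fix a b assume ab: "a \<in> sym_arcs G" "b \<in> sym_arcs G"
  have mem: "prod.swap a \<in> sym_arcs G" using ab(1) by (auto simp: arcs)
  have "(\<Sum>c\<in>sym_arcs G. (if a = prod.swap c then exp (\<i> * complex_of_real (\<theta> c)) else 0) *
          (if snd c = snd b \<and> c \<noteq> b then 1 else 0)) =
        (\<Sum>c\<in>sym_arcs G. if c = prod.swap a then
          (if snd b = fst a \<and> b \<noteq> prod.swap a then cis (\<theta> (prod.swap a)) else 0) else 0)"
  proof (rule sum.cong)
    fix c
    have sw: "a = prod.swap c \<longleftrightarrow> c = prod.swap a" by (metis swap_swap)
    show "(if a = prod.swap c then exp (\<i> * complex_of_real (\<theta> c)) else 0) *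
          (if snd c = snd b \<and> c \<noteq> b then 1 else 0) =
        (if c = prod.swap a then
          (if snd b = fst a \<and> b \<noteq> prod.swap a then cis (\<theta> (prod.swap a)) else 0) else 0)"
      unfolding sw cis_conv_exp[symmetric] by (cases "c = prod.swap a") (simp_all, metis)
  qed simp
  also have "\<dots> = (if snd b = fst a \<and> b \<noteq> prod.swap a then cis (\<theta> (prod.swap a)) else 0)"
    using mem by simp
  finally show "(\<Sum>c\<in>sym_arcs G. (if a = prod.swap c then exp (\<i> * complex_of_real (\<theta> c)) else 0) *
          (if snd c = snd b \<and> c \<noteq> b then 1 else 0)) = (if b = pred_arc a then cis (- \<theta> a) else 0)"
    using pred_arc_iff[OF ab] by (simp add: \<theta>)
qed

text \<open>The power is again monomial, so it is the identity exactly when every arc returns to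
  itself with accumulated weight 1.\<close>

lemma is_return_time_iff:
  assumes \<theta>: "\<And>a. \<theta> (prod.swap a) = - \<theta> a"
  shows "is_return_time G \<theta> \<tau> \<longleftrightarrow>
    0 < \<tau> \<and> n dvd \<tau> \<and> cis (real (\<tau> div n) * (\<Sum>s<n. \<theta> (arc s))) = 1"
proof -
  define \<alpha> where "\<alpha> = (\<Sum>s<n. \<theta> (arc s))"
  define P where "P = (\<lambda>a. \<Prod>s<\<tau>. cis (- \<theta> ((pred_arc ^^ s) a)))"
  have per: "\<theta> (arc (k + n)) = \<theta> (arc k)" for k
    by simp
  have mem: "(pred_arc ^^ t) a \<in> sym_arcs G" if "a \<in> sym_arcs G" for t a
    using that by (induction t) (auto simp: pred_arc_mem)
  have "U_mat G \<theta> ^\<^sub>m \<tau> = 1\<^sub>m (card (sym_arcs G)) \<longleftrightarrow>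
      (\<forall>a\<in>sym_arcs G. \<forall>b\<in>sym_arcs G.
        (if b = (pred_arc ^^ \<tau>) a then P a else 0) = (if a = b then 1 else 0))"
    unfolding U_mat_eq[of \<theta>, OF \<theta>] one_mat_on[OF finite_arcs] P_def
    by (simp add: mat_on_monomial_pow[OF finite_arcs pred_arc_mem] mat_on_eq_iff)
  also have "\<dots> \<longleftrightarrow> (\<forall>a\<in>sym_arcs G. (pred_arc ^^ \<tau>) a = a \<and> P a = 1)"
    by (metis mem zero_neq_one)
  also have "\<dots> \<longleftrightarrow> n dvd \<tau> \<and> cis (real (\<tau> div n) * \<alpha>) = 1"
  proof (cases "n dvd \<tau>")
    case False
    \<comment> \<open>A reversed arc is the witness: its index rises from 0 to \<tau>, so it returns
      only if \<open>n\<close> divides \<tau>.\<close>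
    have "(pred_arc ^^ \<tau>) (y (Suc 0), y 0) \<noteq> (y (Suc 0), y 0)"
      using False by (auto simp: y_eq dvd_eq_mod_eq_0)
    then show ?thesis using False arc_mem(3)[of 0] by metis
  next
    case True
    then obtain r where r: "\<tau> = n * r" ..
    have tau: "\<tau> div n = r" using n3 r by simp
    have fwd: "(pred_arc ^^ \<tau>) (arc (k + \<tau>)) = arc (k + \<tau>) \<and> P (arc (k + \<tau>)) = cis (- (real r * \<alpha>))" for k
    proof
      show "(pred_arc ^^ \<tau>) (arc (k + \<tau>)) = arc (k + \<tau>)"
        unfolding pred_arc_pow_forward using r by (simp add: y_eq)
      \<comment> \<open>The orbit of a forward arc runs through the indices downwards; reversing the
        order of summation gives a window of \<open>r\<close> full turns starting at
        \<open>Suc k\<close>.\<close>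
      have "(\<Sum>s<\<tau>. \<theta> ((pred_arc ^^ s) (arc (k + \<tau>)))) = (\<Sum>s<\<tau>. \<theta> (arc (Suc k + (\<tau> - Suc s))))"
      proof (rule sum.cong)
        fix s assume "s \<in> {..<\<tau>}"
        then have "k + \<tau> = Suc k + (\<tau> - Suc s) + s" by simp
        then show "\<theta> ((pred_arc ^^ s) (arc (k + \<tau>))) = \<theta> (arc (Suc k + (\<tau> - Suc s)))"
          by (metis pred_arc_pow_forward)
      qed simp
      also have "\<dots> = (\<Sum>s<\<tau>. \<theta> (arc (Suc k + s)))"
        by (rule sum.nat_diff_reindex[where g="\<lambda>s. \<theta> (arc (Suc k + s))"])
      also have "\<dots> = real r * \<alpha>"
        unfolding r \<alpha>_def by (rule sum_periodic_mult[where w="\<lambda>s. \<theta> (arc s)", OF per])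
      finally show "P (arc (k + \<tau>)) = cis (- (real r * \<alpha>))"
        by (simp add: P_def prod_cis sum_negf)
    qed
    have bwd: "(pred_arc ^^ \<tau>) (prod.swap (arc k)) = prod.swap (arc k) \<and>
        P (prod.swap (arc k)) = cis (real r * \<alpha>)" for k
    proof
      show "(pred_arc ^^ \<tau>) (prod.swap (arc k)) = prod.swap (arc k)"
        using r by (simp add: y_eq)
      have neg: "\<theta> (y (Suc l), y l) = - \<theta> (arc l)" for l
        using \<theta>[of "arc l"] by simp
      have "P (prod.swap (arc k)) = cis (\<Sum>s<\<tau>. \<theta> (arc (k + s)))"
        by (simp add: P_def prod_cis neg)
      also have "(\<Sum>s<\<tau>. \<theta> (arc (k + s))) = real r * \<alpha>"
        unfolding r \<alpha>_def by (rule sum_periodic_mult[where w="\<lambda>s. \<theta> (arc s)", OF per])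
      finally show "P (prod.swap (arc k)) = cis (real r * \<alpha>)" .
    qed
    have "(\<forall>a\<in>sym_arcs G. (pred_arc ^^ \<tau>) a = a \<and> P a = 1) \<longleftrightarrow> cis (real r * \<alpha>) = 1"
    proof
      assume "\<forall>a\<in>sym_arcs G. (pred_arc ^^ \<tau>) a = a \<and> P a = 1"
      then show "cis (real r * \<alpha>) = 1" using bwd[of 0] arc_mem(2)[of 0] by metis
    next
      assume c: "cis (real r * \<alpha>) = 1"
      then have c': "cis (- (real r * \<alpha>)) = 1" by (simp only: cis_minus_eq_1_iff)
      show "\<forall>a\<in>sym_arcs G. (pred_arc ^^ \<tau>) a = a \<and> P a = 1"
      proof
        fix a assume "a \<in> sym_arcs G"
        then show "(pred_arc ^^ \<tau>) a = a \<and> P a = 1"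
        proof (cases rule: arcE[where t=\<tau>])
          case (1 k)
          then show ?thesis using fwd[of k] c' by metis
        next
          case (2 k)
          then show ?thesis using bwd[of k] c by metis
        qed
      qed
    qed
    then show ?thesis using True tau by simp
  qed
  finally show ?thesis by (simp add: is_return_time_def \<alpha>_def)
qed

end

section \<open>The spectrum of the Hermitian adjacency matrix\<close>

text \<open>The flux through the cycle: the argument, not reduced modulo \<open>2 * pi\<close>, of
  the product of the matrix weights along one turn.\<close>

definition total_phase :: "real \<Rightarrow> 'a pair_pre_digraph \<Rightarrow> nat \<Rightarrow> (nat \<Rightarrow> 'a) \<Rightarrow> real" where
  "total_phase \<eta> G n y = (\<Sum>s<n. eta_fun \<eta> G (y s, y (Suc s)))"

text \<open>Every arc contributes \<eta>, -\<eta> or 0. This carries rationality of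
  \<open>\<eta> / pi\<close> over to the phase, and back again when the integer is not 0.\<close>

lemma total_phase_int_multiple: "\<exists>m::int. total_phase \<eta> G n y = of_int m * \<eta>"
proof (induction n)
  case 0
  show ?case by (rule exI[of _ 0]) (simp add: total_phase_def)
next
  case (Suc n)
  then obtain m :: int where m: "total_phase \<eta> G n y = of_int m * \<eta>" ..
  obtain e :: int where "eta_fun \<eta> G (y n, y (Suc n)) = of_int e * \<eta>"
  proof -
    have "eta_fun \<eta> G (y n, y (Suc n)) = of_int 1 * \<eta> \<or>
      eta_fun \<eta> G (y n, y (Suc n)) = of_int (- 1) * \<eta> \<or>
      eta_fun \<eta> G (y n, y (Suc n)) = of_int 0 * \<eta>"
      by (simp add: eta_fun_def)
    then show thesis using that by blast
  qed
  with m have "total_phase \<eta> G (Suc n) y = of_int (m + e) * \<eta>"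
    by (simp add: total_phase_def algebra_simps)
  then show ?case ..
qed

lemma periodic_mod:
  assumes "\<And>k. F (k + n) = F k"
  shows "F (k mod n) = F (k :: nat)"
proof -
  have "F (l + n * q) = F l" for l q
  proof (induction q)
    case (Suc q)
    then show ?case using assms[of "l + n * q"] by (simp add: algebra_simps)
  qed simp
  then show ?thesis by (metis mod_mult_div_eq)
qed

text \<open>The operator \<open>Z \<mapsto> (k \<mapsto> Z (k + 1) - cis (- \<phi>) * Z k)\<close> turns a solution of the
  recurrence into a geometric progression with ratio \<open>cis \<phi>\<close>.\<close>

lemma two_cos_recurrence_multiplier:
  fixes Z :: "nat \<Rightarrow> complex"
  assumes nz: "Z l \<noteq> 0"
    and per: "\<And>k. Z (k + n) = cis \<alpha> * Z k"
    and rec: "\<And>k. Z (Suc (Suc k)) + Z k = complex_of_real (2 * cos \<phi>) * Z (Suc k)"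
  shows "cis (real n * \<phi>) = cis \<alpha> \<or> cis (- (real n * \<phi>)) = cis \<alpha>"
proof -
  define u where "u = (\<lambda>k. Z (Suc k) - cis (- \<phi>) * Z k)"
  have cc: "complex_of_real (2 * cos \<phi>) = cis \<phi> + cis (- \<phi>)"
    by (simp add: complex_eq_iff)
  have inv: "cis \<phi> * cis (- \<phi>) = 1" by (simp add: cis_mult)
  have "u (Suc k) = cis \<phi> * u k" for k
  proof -
    have "Z (Suc (Suc k)) = (cis \<phi> + cis (- \<phi>)) * Z (Suc k) - Z k"
      using rec[of k] unfolding cc by (simp add: algebra_simps)
    then have "u (Suc k) = cis \<phi> * Z (Suc k) - (cis \<phi> * cis (- \<phi>)) * Z k"
      by (simp add: u_def inv algebra_simps del: cis_mult)
    then show ?thesis by (simp add: u_def algebra_simps)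
  qed
  then have u: "u k = cis \<phi> ^ k * u 0" for k
    by (induction k) (simp_all add: mult.assoc)
  show ?thesis
  \<comment> \<open>If \<open>u\<close> vanishes, \<open>Z\<close> itself is geometric with ratio
    \<open>cis (- \<phi>)\<close>; otherwise \<open>u\<close> inherits the twisted periodicity of
    \<open>Z\<close>. The argument also covers coinciding ratios \<open>cis \<phi>\<close> and
    \<open>cis (- \<phi>)\<close>.\<close>
  proof (cases "u 0 = 0")
    case True
    then have "Z (Suc k) = cis (- \<phi>) * Z k" for k
      using u[of k] by (simp add: u_def)
    then have Z: "Z k = cis (- \<phi>) ^ k * Z 0" for k
      by (induction k) (simp_all add: mult.assoc)
    then have "Z 0 \<noteq> 0" using nz by (metis mult_zero_right)
    moreover have "cis \<alpha> * Z 0 = cis (- \<phi>) ^ n * Z 0"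
      using per[of 0] Z[of n] by (metis add_0)
    ultimately show ?thesis by (simp add: DeMoivre)
  next
    case False
    have "u n = cis \<alpha> * u 0"
      using per[of 0] per[of "Suc 0"] by (simp add: u_def algebra_simps)
    with False u[of n] show ?thesis by (simp add: DeMoivre)
  qed
qed

context labelled_cycle
begin

lemma H_row_sum:
  "(\<Sum>z\<in>pverts G.
      (if (y (Suc k), z) \<in> sym_arcs G then cis (eta_fun \<eta> G (y (Suc k), z)) else 0) * v z) =
    cis (eta_fun \<eta> G (arc (Suc k))) * v (y (Suc (Suc k))) + cis (- eta_fun \<eta> G (arc k)) * v (y k)"
proof -
  have reversed: "eta_fun \<eta> G (y (Suc k), y k) = - eta_fun \<eta> G (arc k)"
    using eta_fun_swap[of \<eta> G "arc k"] by simp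
  have "(\<Sum>z\<in>pverts G.
      (if (y (Suc k), z) \<in> sym_arcs G then cis (eta_fun \<eta> G (y (Suc k), z)) else 0) * v z) =
    (\<Sum>z\<in>{y k, y (Suc (Suc k))}. cis (eta_fun \<eta> G (y (Suc k), z)) * v z)"
    unfolding arc_from_iff by (rule sum.mono_neutral_cong_right) auto
  then show ?thesis by (simp add: reversed)
qed

text \<open>Picks the label below \<open>n\<close> of a vertex; through it an
  \<open>n\<close>-periodic sequence descends to a function on the vertices.\<close>

definition idx :: "'a \<Rightarrow> nat" where
  "idx = inv_into {..<n} y"

lemma periodic_idx:
  assumes "\<And>k. F (k + n) = F k"
  shows "F (idx (y k)) = F k"
proof -
  have "y k = y (k mod n)" by (simp add: y_eq)
  then have "idx (y k) = k mod n"
    using n3 inv_into_f_f[OF inj_y, of "k mod n"] by (simp add: idx_def)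
  then show ?thesis by (simp add: periodic_mod[of F, OF assms])
qed

lemma eta_fun_periodic: "eta_fun \<eta> G (arc (k + n)) = eta_fun \<eta> G (arc k)"
  by simp

definition partial_phase :: "real \<Rightarrow> nat \<Rightarrow> real" where
  "partial_phase \<eta> k = (\<Sum>s<k. eta_fun \<eta> G (arc s))"

lemma partial_phase_Suc: "partial_phase \<eta> (Suc k) = partial_phase \<eta> k + eta_fun \<eta> G (arc k)"
  by (simp add: partial_phase_def)

lemma partial_phase_add: "partial_phase \<eta> (k + n) = partial_phase \<eta> k + total_phase \<eta> G n y"
  unfolding partial_phase_def total_phase_def sum_lessThan_add
  using sum_periodic_shift[of "\<lambda>s. eta_fun \<eta> G (arc s)" n k, OF eta_fun_periodic] by simp

text \<open>Multiplying an eigenvector by the unit complex numbers with argument \<^const>\<open>partial_phase\<close>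
  removes the weights of the arcs, at the price of a twisted periodicity.\<close>

lemma eigenvalue_H_mat_iff:
  "eigenvalue (H_mat \<eta> G) \<mu> \<longleftrightarrow>
    (\<exists>Z. (\<exists>k. Z k \<noteq> 0) \<and> (\<forall>k. Z (k + n) = cis (total_phase \<eta> G n y) * Z k) \<and>
      (\<forall>k. Z (Suc (Suc k)) + Z k = \<mu> * Z (Suc k)))"
proof -
  let ?w = "\<lambda>k. eta_fun \<eta> G (arc k)" and ?W = "partial_phase \<eta>"
  \<comment> \<open>The row equation at \<open>y (Suc k)\<close> is multiplied by the unit
    \<open>cis (?W (Suc k))\<close>, which absorbs both arc weights into the partial phases.\<close>
  have gauge: "cis (?w (Suc k)) * a + cis (- ?w k) * b = \<mu> * c \<longleftrightarrow>
    cis (?W (Suc (Suc k))) * a + cis (?W k) * b = \<mu> * (cis (?W (Suc k)) * c)" for a b c k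
  proof -
    have W: "cis (?W (Suc (Suc k))) = cis (?W (Suc k)) * cis (?w (Suc k))"
      "cis (?W k) = cis (?W (Suc k)) * cis (- ?w k)"
      by (simp_all add: cis_mult partial_phase_Suc)
    have "cis (?W (Suc (Suc k))) * a + cis (?W k) * b - \<mu> * (cis (?W (Suc k)) * c) =
      cis (?W (Suc k)) * (cis (?w (Suc k)) * a + cis (- ?w k) * b - \<mu> * c)"
      unfolding W by (simp only: algebra_simps)
    moreover have "cis (?W (Suc k)) \<noteq> 0" by simp
    ultimately show ?thesis
      by (metis (no_types) eq_iff_diff_eq_0 mult_eq_0_iff)
  qed
  have "eigenvalue (H_mat \<eta> G) \<mu> \<longleftrightarrow>
    (\<exists>v. (\<exists>x\<in>pverts G. v x \<noteq> 0) \<and>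
      (\<forall>x\<in>pverts G. (\<Sum>z\<in>pverts G.
        (if (x, z) \<in> sym_arcs G then cis (eta_fun \<eta> G (x, z)) else 0) * v z) = \<mu> * v x))"
    unfolding H_mat_eq by (rule eigenvalue_mat_on) simp
  also have "\<dots> \<longleftrightarrow> (\<exists>v. (\<exists>k. v (y k) \<noteq> 0) \<and>
      (\<forall>k. cis (?w (Suc k)) * v (y (Suc (Suc k))) + cis (- ?w k) * v (y k) = \<mu> * v (y (Suc k))))"
    (is "(\<exists>v. ?P v) \<longleftrightarrow> (\<exists>v. ?Q v)")
  proof -
    have "?P v \<longleftrightarrow> ?Q v" for v
    proof -
      have "(\<exists>x\<in>pverts G. v x \<noteq> 0) \<longleftrightarrow> (\<exists>k. v (y k) \<noteq> 0)"
        by (auto simp: verts)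
      moreover have "(\<forall>x\<in>pverts G. R x) \<longleftrightarrow> (\<forall>k. R (y (Suc k)))" for R
        by (metis vert_SucE y_mem)
      ultimately show ?thesis by (simp only: H_row_sum)
    qed
    then show ?thesis by blast
  qed
  also have "\<dots> \<longleftrightarrow>
    (\<exists>Z. (\<exists>k. Z k \<noteq> 0) \<and> (\<forall>k. Z (k + n) = cis (total_phase \<eta> G n y) * Z k) \<and>
      (\<forall>k. Z (Suc (Suc k)) + Z k = \<mu> * Z (Suc k)))" (is "(\<exists>v. ?Q v) \<longleftrightarrow> (\<exists>Z. ?R Z)")
  proof
    assume "\<exists>v. ?Q v"
    then obtain v where v: "?Q v" ..
    have "cis (?W (k + n)) = cis (total_phase \<eta> G n y) * cis (?W k)" for k
      by (simp add: partial_phase_add cis_mult add.commute)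
    then have "?R (\<lambda>k. cis (?W k) * v (y k))"
      using v unfolding gauge by simp
    then show "\<exists>Z. ?R Z" by (rule exI[where P="?R"])
  next
    assume "\<exists>Z. ?R Z"
    then obtain Z where Z: "?R Z" ..
    \<comment> \<open>Undoing the gauge cancels the twist, so \<open>V\<close> is truly
      \<open>n\<close>-periodic and gives a function on the vertices.\<close>
    define V where "V = (\<lambda>k. cis (- ?W k) * Z k)"
    have "V (k + n) = V k" for k
    proof -
      have "V (k + n) = cis (- (?W k + total_phase \<eta> G n y)) * (cis (total_phase \<eta> G n y) * Z k)"
        using Z by (simp add: V_def partial_phase_add)
      then show ?thesis by (simp add: V_def cis_mult flip: mult.assoc)
    qed
    then have V: "V (idx (y k)) = V k" for k by (rule periodic_idx)
    have WV: "cis (?W k) * V k = Z k" for k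
      by (simp add: V_def cis_mult flip: mult.assoc)
    have "?Q (\<lambda>x. V (idx x))"
      using Z unfolding gauge V WV by (auto simp: V_def)
    then show "\<exists>v. ?Q v" by (rule exI[where P="?Q"])
  qed
  finally show ?thesis .
qed

text \<open>With \<alpha> the total phase, the geometric sequence of ratio
  \<open>cis (\<alpha> / n)\<close> solves the recurrence and picks up exactly
  \<open>cis \<alpha>\<close> after \<open>n\<close> steps.\<close>

lemma eigenvalue_two_cos:
  "eigenvalue (H_mat \<eta> G) (complex_of_real (2 * cos (total_phase \<eta> G n y / real n)))"
proof -
  let ?\<phi> = "total_phase \<eta> G n y / real n"
  let ?Z = "\<lambda>k. cis (real k * ?\<phi>)"
  have "?Z 0 \<noteq> 0" by simp
  moreover have "?Z (k + n) = cis (total_phase \<eta> G n y) * ?Z k" for k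
    using n3 by (simp add: cis_mult algebra_simps add_divide_distrib)
  moreover have "?Z (Suc (Suc k)) + ?Z k = complex_of_real (2 * cos ?\<phi>) * ?Z (Suc k)" for k
  proof -
    have "complex_of_real (2 * cos ?\<phi>) = cis ?\<phi> + cis (- ?\<phi>)"
      by (simp add: complex_eq_iff)
    moreover have "?Z (Suc (Suc k)) = cis ?\<phi> * ?Z (Suc k)" "?Z k = cis (- ?\<phi>) * ?Z (Suc k)"
      unfolding cis_mult by (simp_all add: algebra_simps add_divide_distrib)
    ultimately show ?thesis by (simp only: distrib_right)
  qed
  ultimately show ?thesis
    unfolding eigenvalue_H_mat_iff
    by (intro exI[of _ ?Z] conjI allI exI[of _ 0])
qed

end

section \<open>Cospectrality and the total phase\<close>

lemma eigenvalue_iff_mem_spectrum: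
  assumes "A \<in> carrier_mat n n"
  shows "eigenvalue A k \<longleftrightarrow> k \<in># mat_spectrum A"
proof -
  \<comment> \<open>A root multiset detects roots only of a nonzero polynomial; the characteristic
    polynomial is monic.\<close>
  have "char_poly A \<noteq> 0"
    using degree_monic_char_poly[OF assms] by (metis coeff_0 zero_neq_one)
  then show ?thesis
    by (simp add: eigenvalue_root_char_poly[OF assms] mat_spectrum_def)
qed

lemma H_mat_carrier: "H_mat \<eta> G \<in> carrier_mat (card (pverts G)) (card (pverts G))"
  by (simp add: H_mat_def)

text \<open>One shared eigenvalue suffices: \<open>2 * cos (\<alpha> / n)\<close>, with \<alpha> the
  phase of \<open>G\<close>, must admit a solution of the recurrence of \<open>G'\<close>. The sign
  stays open because cosine is even.\<close>

lemma H_cospectral_imp_phase: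
  assumes "labelled_cycle G n y" "labelled_cycle G' n y'" "H_cospectral \<eta> G G'"
  shows "cis (total_phase \<eta> G n y) = cis (total_phase \<eta> G' n y') \<or>
    cis (- total_phase \<eta> G n y) = cis (total_phase \<eta> G' n y')"
proof -
  interpret G: labelled_cycle G n y by fact
  interpret G': labelled_cycle G' n y' by fact
  let ?\<phi> = "total_phase \<eta> G n y / real n"
  have n: "real n * ?\<phi> = total_phase \<eta> G n y" using G.n3 by simp
  have "eigenvalue (H_mat \<eta> G') (complex_of_real (2 * cos ?\<phi>))"
    using G.eigenvalue_two_cos[of \<eta>] assms(3)
    by (simp only: H_cospectral_def eigenvalue_iff_mem_spectrum[OF H_mat_carrier])
  then show ?thesis
    unfolding G'.eigenvalue_H_mat_iff using two_cos_recurrence_multiplier[of _ _ n _ ?\<phi>]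
    unfolding n by blast
qed

text \<open>The matrices are conjugate by a relabelling combined with a diagonal of unit complex
  numbers. Applied to \<open>std_mixed_cycle n 0\<close>, this makes every cycle of phase 0
  cospectral with it.\<close>

lemma H_cospectral_of_phase_eq:
  assumes "labelled_cycle G n y" "labelled_cycle G' n y'"
    and phase: "total_phase \<eta> G n y = total_phase \<eta> G' n y'"
  shows "H_cospectral \<eta> G G'"
proof -
  interpret G: labelled_cycle G n y by fact
  interpret G': labelled_cycle G' n y' by fact
  let ?V = "pverts G" and ?V' = "pverts G'"
  define \<phi> where "\<phi> = (\<lambda>x. y' (G.idx x))"
  \<comment> \<open>This difference is \<open>n\<close>-periodic because the total phases agree, so
    \<open>cis (D k)\<close> descends to a function \<open>d\<close> on the vertices.\<close>
  define D where "D = (\<lambda>k. G'.partial_phase \<eta> k - G.partial_phase \<eta> k)"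
  define d where "d = (\<lambda>x. cis (D (G.idx x)))"
  have \<phi>: "\<phi> (y k) = y' k" for k
    unfolding \<phi>_def by (rule G.periodic_idx[where F=y']) simp
  have d: "d (y k) = cis (D k)" for k
    unfolding d_def
    by (rule G.periodic_idx[where F="\<lambda>k. cis (D k)"])
       (simp add: D_def G.partial_phase_add G'.partial_phase_add phase)
  have \<phi>_mem: "\<phi> x \<in> ?V'" for x by (simp add: \<phi>_def)
  have inj: "\<phi> x = \<phi> z \<longleftrightarrow> x = z" if "x \<in> ?V" "z \<in> ?V" for x z
    using that by (auto simp: G.verts \<phi> G.y_eq G'.y_eq)
  define h where "h = (\<lambda>x z. if (x, z) \<in> sym_arcs G then cis (eta_fun \<eta> G (x, z)) else 0)"
  define h' where "h' = (\<lambda>x z. if (x, z) \<in> sym_arcs G' then cis (eta_fun \<eta> G' (x, z)) else 0)"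
  define P where "P = mat_on ?V ?V' (\<lambda>x z. if z = \<phi> x then d x else 0)"
  define Q where "Q = mat_on ?V' ?V (\<lambda>z x. if z = \<phi> x then cnj (d x) else 0)"
  have P_carr: "P \<in> carrier_mat n n" and Q_carr: "Q \<in> carrier_mat n n"
    unfolding P_def Q_def mat_on_def G.card_verts G'.card_verts by (rule mat_carrier)+
  have H_carr: "H_mat \<eta> G \<in> carrier_mat n n" "H_mat \<eta> G' \<in> carrier_mat n n"
    using H_mat_carrier[of \<eta> G] H_mat_carrier[of \<eta> G']
    unfolding G.card_verts G'.card_verts .
  have PM: "mat_on ?V ?V' (\<lambda>x z. if z = \<phi> x then d x else 0) * mat_on ?V' ?V' g =
      mat_on ?V ?V' (\<lambda>x z. d x * g (\<phi> x) z)" for g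
    unfolding mat_on_mult
  proof (rule mat_on_cong)
    fix x z
    have "(\<Sum>b\<in>?V'. (if b = \<phi> x then d x else 0) * g b z) =
      (\<Sum>b\<in>?V'. if b = \<phi> x then d x * g b z else 0)"
      by (rule sum.cong) simp_all
    then show "(\<Sum>b\<in>?V'. (if b = \<phi> x then d x else 0) * g b z) = d x * g (\<phi> x) z"
      using \<phi>_mem by simp
  qed
  have MQ: "mat_on ?V ?V' g * Q = mat_on ?V ?V (\<lambda>x z. g x (\<phi> z) * cnj (d z))" for g
    unfolding Q_def mat_on_mult
  proof (rule mat_on_cong)
    fix x z
    have "(\<Sum>b\<in>?V'. g x b * (if b = \<phi> z then cnj (d z) else 0)) =
      (\<Sum>b\<in>?V'. if b = \<phi> z then g x b * cnj (d z) else 0)"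
      by (rule sum.cong) simp_all
    then show "(\<Sum>b\<in>?V'. g x b * (if b = \<phi> z then cnj (d z) else 0)) = g x (\<phi> z) * cnj (d z)"
      using \<phi>_mem by simp
  qed
  have "P * Q = mat_on ?V ?V (\<lambda>x z. if x = z then 1 else 0)"
    unfolding P_def MQ by (rule mat_on_cong) (auto simp: inj d_def cis_cnj cis_mult)
  then have PQ: "P * Q = 1\<^sub>m n"
    using one_mat_on[OF G.finite_verts] by (simp add: G.card_verts)
  then have QP: "Q * P = 1\<^sub>m n"
    by (rule mat_mult_left_right_inverse[OF P_carr Q_carr])
  \<comment> \<open>From \<open>y k\<close> to \<open>y (Suc k)\<close> the value of
    \<open>D\<close> changes by the difference of the two \<eta>-functions on that arc, which trades
    the weight of \<open>G'\<close> for that of \<open>G\<close>.\<close>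
  have entry: "d x * h' (\<phi> x) (\<phi> z) * cnj (d z) = h x z" if xz: "x \<in> ?V" "z \<in> ?V" for x z
  proof -
    obtain k where x: "x = y (Suc k)" using xz(1) by (rule G.vert_SucE)
    have iff: "(\<phi> x, \<phi> z) \<in> sym_arcs G' \<longleftrightarrow> (x, z) \<in> sym_arcs G"
      unfolding x G.arc_from_iff \<phi> G'.arc_from_iff
      using inj[OF xz(2), of "y k"] inj[OF xz(2), of "y (Suc (Suc k))"] by (simp add: \<phi>)
    show ?thesis
    proof (cases "(x, z) \<in> sym_arcs G")
      case True
      then consider "z = y k" | "z = y (Suc (Suc k))"
        unfolding x G.arc_from_iff by blast
      then show ?thesis
      proof cases
        case 1
        have "eta_fun \<eta> G (x, z) = - eta_fun \<eta> G (y k, y (Suc k))"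
          "eta_fun \<eta> G' (\<phi> x, \<phi> z) = - eta_fun \<eta> G' (y' k, y' (Suc k))"
          using eta_fun_swap[of \<eta> G "(y k, y (Suc k))"] eta_fun_swap[of \<eta> G' "(y' k, y' (Suc k))"]
          by (simp_all add: x 1 \<phi>)
        then show ?thesis
          using True iff
          by (simp add: h_def h'_def)
             (simp add: x 1 d cis_cnj cis_mult D_def G.partial_phase_Suc G'.partial_phase_Suc)
      next
        case 2
        then show ?thesis
          using True iff
          by (simp add: h_def h'_def)
             (simp add: x 2 d \<phi> cis_cnj cis_mult D_def G.partial_phase_Suc G'.partial_phase_Suc)
      qed
    qed (simp add: h_def h'_def iff)
  qed
  have "H_mat \<eta> G = P * H_mat \<eta> G' * Q"
    unfolding H_mat_eq P_def PM MQ h_def[symmetric] h'_def[symmetric]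
    by (rule mat_on_cong) (use entry in \<open>simp add: h_def h'_def\<close>)
  then have "similar_mat (H_mat \<eta> G) (H_mat \<eta> G')"
    using P_carr Q_carr H_carr PQ QP by (intro similar_matI[of _ _ P Q n]) auto
  then show ?thesis
    by (simp add: H_cospectral_def mat_spectrum_def char_poly_similar)
qed

section \<open>Mixed cycles and their periods\<close>

lemma mixed_cycle_labelled:
  assumes "mixed_cycle G"
  obtains y where "labelled_cycle G (card (pverts G)) y"
proof -
  define n where "n = card (pverts G)"
  from assms obtain x where n3: "3 \<le> n" and bij: "bij_betw x {..<n} (pverts G)"
    and arcs: "sym_arcs G = (\<Union>i<n. {(x i, x (Suc i mod n)), (x (Suc i mod n), x i)})"
    unfolding mixed_cycle_def n_def by blast
  have lt: "k mod n < n" for k using n3 by simp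
  \<comment> \<open>Reading labels modulo \<open>n\<close> only repeats the same edges, so the union
    may run over all natural numbers.\<close>
  have UN: "(\<Union>i<n. {(x i, x (Suc i mod n)), (x (Suc i mod n), x i)}) =
      (\<Union>k. {(x (k mod n), x (Suc k mod n)), (x (Suc k mod n), x (k mod n))})" (is "?A = ?B")
  proof
    show "?A \<subseteq> ?B" by (force simp: mod_less)
    show "?B \<subseteq> ?A"
    proof
      fix a assume "a \<in> ?B"
      then obtain k where "a = (x (k mod n), x (Suc k mod n)) \<or> a = (x (Suc k mod n), x (k mod n))"
        by blast
      moreover have "Suc k mod n = Suc (k mod n) mod n" by (simp add: mod_Suc_eq)
      ultimately show "a \<in> ?A" using lt[of k] by auto
    qed
  qed
  have "labelled_cycle G n (\<lambda>k. x (k mod n))"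
  proof
    show "3 \<le> n" by fact
    show "x (k mod n) = x (l mod n) \<longleftrightarrow> k mod n = l mod n" for k l
      using bij lt by (auto simp: bij_betw_def inj_on_def)
    have "x ` {..<n} = range (\<lambda>k. x (k mod n))"
      using lt by (auto simp: image_iff) (metis mod_less)
    then show "pverts G = range (\<lambda>k. x (k mod n))"
      using bij by (simp add: bij_betw_def)
    show "sym_arcs G = range (\<lambda>k. (x (k mod n), x (Suc k mod n))) \<union>
        range (\<lambda>k. (x (Suc k mod n), x (k mod n)))"
      unfolding arcs UN by blast
  qed
  then show thesis using that unfolding n_def by blast
qed

section \<open>Labelling and phase of the standard mixed cycles\<close>

lemma parcs_std_mixed_cycle:
  "(a, b) \<in> parcs (std_mixed_cycle n j) \<longleftrightarrow>
    a \<in> {1..j} \<and> b = cyc_next n a \<or> a \<in> {j+1..n} \<and> b = cyc_next n a \<or>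
    b \<in> {j+1..n} \<and> a = cyc_next n b"
  by (auto simp: std_mixed_cycle_def)

lemma cyc_next_mod: "k < n \<Longrightarrow> cyc_next n (Suc k) = Suc (Suc k mod n)"
  by (auto simp: cyc_next_def)

lemma cyc_next_mod_mod: "0 < n \<Longrightarrow> cyc_next n (Suc (k mod n)) = Suc (Suc k mod n)"
  by (simp add: cyc_next_mod mod_Suc_eq)

text \<open>Vertices are numbered from 1, hence the outer \<open>Suc\<close>. One-way arcs and
  digons have the same symmetric closure, so one labelling serves every \<open>j\<close>.\<close>

lemma std_mixed_cycle_labelled:
  assumes "3 \<le> n" "j \<le> n"
  shows "labelled_cycle (std_mixed_cycle n j) n (\<lambda>k. Suc (k mod n))"
proof
  show "3 \<le> n" by fact
  show "Suc (k mod n) = Suc (l mod n) \<longleftrightarrow> k mod n = l mod n" for k l by simp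
  have surj: "\<exists>k. i = Suc (k mod n)" if "i \<in> {1..n}" for i
    using that by (intro exI[of _ "i - 1"]) auto
  have lt: "k mod n < n" for k using assms by simp
  show "pverts (std_mixed_cycle n j) = range (\<lambda>k. Suc (k mod n))"
    using surj lt by (auto simp: std_mixed_cycle_def Suc_le_eq image_iff)
  have sym: "(a, b) \<in> sym_arcs (std_mixed_cycle n j) \<longleftrightarrow>
      a \<in> {1..n} \<and> b = cyc_next n a \<or> b \<in> {1..n} \<and> a = cyc_next n b" for a b
    using assms unfolding sym_arcs_eq Un_iff converse_iff parcs_std_mixed_cycle by auto
  have split: "a \<in> {1..n} \<and> b = cyc_next n a \<longleftrightarrow> (\<exists>k. a = Suc (k mod n) \<and> b = Suc (Suc k mod n))" for a b
  proof
    assume *: "a \<in> {1..n} \<and> b = cyc_next n a"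
    then obtain k where "a = Suc (k mod n)" using surj by blast
    with * show "\<exists>k. a = Suc (k mod n) \<and> b = Suc (Suc k mod n)"
      using assms by (auto simp: cyc_next_mod_mod)
  next
    assume "\<exists>k. a = Suc (k mod n) \<and> b = Suc (Suc k mod n)"
    then show "a \<in> {1..n} \<and> b = cyc_next n a"
      using assms lt by (auto simp: cyc_next_mod_mod Suc_le_eq)
  qed
  show "sym_arcs (std_mixed_cycle n j) = range (\<lambda>k. (Suc (k mod n), Suc (Suc k mod n))) \<union>
      range (\<lambda>k. (Suc (Suc k mod n), Suc (k mod n)))"
    using sym unfolding split by (auto simp del: One_nat_def simp: set_eq_iff image_iff)
qed

lemma total_phase_std_mixed_cycle:
  assumes "3 \<le> n" "j \<le> n"
  shows "total_phase \<eta> (std_mixed_cycle n j) n (\<lambda>k. Suc (k mod n)) = real j * \<eta>"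
proof -
  have "eta_fun \<eta> (std_mixed_cycle n j) (Suc (s mod n), Suc (Suc s mod n)) =
      (if s < j then \<eta> else 0)" if "s < n" for s
  proof -
    \<comment> \<open>As \<open>3 \<le> n\<close>, two steps never lead back, so a reversed arc is
      present only as half of a digon. Index \<open>s\<close> belongs to vertex
      \<open>Suc s\<close>, so the one-way arcs are those with \<open>s < j\<close>.\<close>
    have "cyc_next n (cyc_next n (Suc s)) \<noteq> Suc s" "cyc_next n (Suc s) \<noteq> Suc s"
      using assms that by (auto simp: cyc_next_def)
    then have "(Suc s, cyc_next n (Suc s)) \<in> parcs (std_mixed_cycle n j)"
      "(cyc_next n (Suc s), Suc s) \<in> parcs (std_mixed_cycle n j) \<longleftrightarrow> j \<le> s"
      using assms that by (auto simp: parcs_std_mixed_cycle)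
    then show ?thesis
      using that by (simp add: eta_fun_def cyc_next_mod)
  qed
  then have "total_phase \<eta> (std_mixed_cycle n j) n (\<lambda>k. Suc (k mod n)) =
      (\<Sum>s<n. if s < j then \<eta> else 0)"
    unfolding total_phase_def by (intro sum.cong) auto
  also have "\<dots> = (\<Sum>s<j. \<eta>)"
    using assms(2) by (intro sum.mono_neutral_cong_right) auto
  finally show ?thesis by simp
qed

section \<open>Divisibility conditions for return times\<close>

lemma dvd_mult_iff_div_gcd_dvd:
  fixes a b r :: nat
  assumes "0 < a"
  shows "a dvd r * b \<longleftrightarrow> a div gcd b a dvd r"
proof -
  let ?g = "gcd b a"
  have g: "0 < ?g" using assms by simp
  \<comment> \<open>After division by the gcd the cofactors are coprime, so Euclid's lemma removes
    the one of \<open>b\<close>.\<close>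
  have cop: "coprime (a div ?g) (b div ?g)"
    using div_gcd_coprime[of b a] assms by (simp add: coprime_commute)
  have "a dvd r * b \<longleftrightarrow> ?g * (a div ?g) dvd ?g * (r * (b div ?g))"
    by (simp add: mult.left_commute)
  also have "\<dots> \<longleftrightarrow> a div ?g dvd r * (b div ?g)"
    by (rule nat_mult_dvd_cancel1[OF g])
  also have "\<dots> \<longleftrightarrow> a div ?g dvd r"
    using cop by (rule coprime_dvd_mult_left_iff)
  finally show ?thesis .
qed

lemma cis_pi_multiple_eq_1_iff:
  assumes "0 < q"
  shows "cis (real a * (real p / real q * pi)) = 1 \<longleftrightarrow> 2 * q dvd a * p"
proof -
  have "cis (real a * (real p / real q * pi)) = 1 \<longleftrightarrow> (\<exists>N::int. real (a * p) = of_int (N * (2 * int q)))"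
    unfolding cis_eq_1_iff using assms by (simp add: field_simps)
  also have "\<dots> \<longleftrightarrow> (\<exists>N::int. int (a * p) = N * (2 * int q))"
    by (metis of_int_eq_iff of_int_of_nat_eq)
  also have "\<dots> \<longleftrightarrow> int (2 * q) dvd int (a * p)"
    by (auto simp: dvd_def mult.commute)
  finally show ?thesis by (simp only: of_nat_dvd_iff)
qed

lemma two_q_dvd_iff:
  fixes j p q r :: nat
  assumes "0 < q" "coprime p q"
  shows "2 * q dvd r * j * p \<longleftrightarrow>
    (if odd p then 2 * q div gcd j (2 * q) else q div gcd j q) dvd r"
proof (cases "odd p")
  case True
  then have "coprime (2 * q) p"
    using assms(2) by (simp add: coprime_commute)
  then show ?thesis
    using True dvd_mult_iff_div_gcd_dvd[of "2 * q" r j] assms(1)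
    by (simp add: coprime_dvd_mult_left_iff)
next
  case False
  then obtain p' where p': "p = 2 * p'" by auto
  then have "coprime q p'"
    using assms(2) by (simp add: coprime_commute)
  then have "q dvd r * j * p' \<longleftrightarrow> q dvd r * j"
    by (rule coprime_dvd_mult_left_iff)
  moreover have "2 * q dvd r * j * p \<longleftrightarrow> 2 * q dvd 2 * (r * j * p')"
    by (simp add: p' mult_ac)
  ultimately show ?thesis
    using False dvd_mult_iff_div_gcd_dvd[of q r j] assms(1) by simp
qed

lemma Least_multiple:
  fixes n c :: nat
  assumes "0 < n" "0 < c"
  shows "(LEAST t. 0 < t \<and> n dvd t \<and> c dvd t div n) = n * c"
proof (rule Least_equality)
  show "0 < n * c \<and> n dvd n * c \<and> c dvd n * c div n"
    using assms by simp
  fix t assume t: "0 < t \<and> n dvd t \<and> c dvd t div n"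
  then have "n * c dvd t" by (auto elim!: dvdE simp: assms)
  then show "n * c \<le> t" using t by (auto dest: dvd_imp_le)
qed

text \<open>By De Moivre's formula only the \<open>r\<close>-th power of a point on the unit circle
  matters, and inverting it does not affect whether it is 1.\<close>

lemma cis_mult_nat_eq_1_cong:
  assumes "cis \<alpha> = cis \<beta> \<or> cis (- \<alpha>) = cis \<beta>"
  shows "cis (real r * \<alpha>) = 1 \<longleftrightarrow> cis (real r * \<beta>) = 1"
proof -
  have "cis (real r * \<beta>) = cis (real r * \<alpha>) \<or> cis (real r * \<beta>) = cis (- (real r * \<alpha>))"
    using assms DeMoivre[of \<alpha> r] DeMoivre[of \<beta> r] DeMoivre[of "- \<alpha>" r] by auto
  then show ?thesis using cis_minus_eq_1_iff by metis
qed

text \<open>The passage from periodicity to rationality excludes cycles cospectral with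
  \<open>std_mixed_cycle n 0\<close>: a cycle of phase 0 is of this kind and has return time
  \<open>n\<close> for every \<eta>. The convention for a zero argument is
  \<open>gcd 0 m = m\<close>.\<close>

theorem theorem1p3:
  fixes G :: "'a pair_pre_digraph" and \<eta> :: real and n :: nat
    and \<theta> :: "'a \<times> 'a \<Rightarrow> real"
  assumes "0 \<le> \<eta>" and "\<eta> < 2 * pi"
    and "3 \<le> n" and "mixed_cycle G" and "card (pverts G) = n"
    and "\<theta> = eta_fun \<eta> G"
  shows "(\<eta> \<in> rat_mult_pi \<longrightarrow> qw_periodic G \<theta>) \<and>
    (\<not> H_cospectral \<eta> G (std_mixed_cycle n 0) \<longrightarrow>
       (qw_periodic G \<theta> \<longleftrightarrow> \<eta> \<in> rat_mult_pi)) \<and>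
    (\<forall>j p q :: nat. \<eta> \<in> rat_mult_pi \<longrightarrow> j \<le> n \<longrightarrow>
       H_cospectral \<eta> G (std_mixed_cycle n j) \<longrightarrow>
       1 \<le> q \<longrightarrow> coprime p q \<longrightarrow> \<eta> = real p / real q * pi \<longrightarrow>
       qw_period G \<theta> =
         (if odd p then 2 * q * n div gcd j (2 * q) else q * n div gcd j q))"
proof -
  obtain y where lab: "labelled_cycle G n y"
    using mixed_cycle_labelled[OF assms(4)] assms(5) by metis
  interpret labelled_cycle G n y by fact
  let ?\<alpha> = "total_phase \<eta> G n y"
  have n_pos: "0 < n" using n3 by simp
  have ret: "is_return_time G \<theta> \<tau> \<longleftrightarrow>
      0 < \<tau> \<and> n dvd \<tau> \<and> cis (real (\<tau> div n) * ?\<alpha>) = 1" for \<tau>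
    unfolding assms(6) total_phase_def by (rule is_return_time_iff) (rule eta_fun_swap)
  obtain m :: int where m: "?\<alpha> = of_int m * \<eta>"
    using total_phase_int_multiple by blast
  have periodic: "qw_periodic G \<theta>" if rat: "\<eta> \<in> rat_mult_pi"
  proof -
    obtain r where "r \<in> \<rat>" "\<eta> = r * pi"
      using rat by (auto simp: rat_mult_pi_def)
    then obtain a b :: int where b: "0 < b" and \<eta>: "\<eta> = of_int a / of_int b * pi"
      by (metis Rats_cases')
    \<comment> \<open>Twice the denominator clears the fraction and makes the phase a multiple of a
      full turn, whatever the parity of \<open>m * a\<close>.\<close>
    have "real (nat (2 * b)) * ?\<alpha> = of_int (m * a) * (2 * pi)"
      unfolding m using b by (simp add: \<eta> field_simps)
    then have "cis (real (nat (2 * b)) * ?\<alpha>) = 1"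
      unfolding cis_eq_1_iff by blast
    then have "is_return_time G \<theta> (n * nat (2 * b))"
      unfolding ret using b n_pos by simp
    then show ?thesis unfolding qw_periodic_def ..
  qed
  have rational: "\<eta> \<in> rat_mult_pi"
    if not_cosp: "\<not> H_cospectral \<eta> G (std_mixed_cycle n 0)" and per: "qw_periodic G \<theta>"
  proof -
    \<comment> \<open>A zero phase would equal that of \<open>std_mixed_cycle n 0\<close> and force
      cospectrality. Hence \<open>m\<close> is nonzero and the return condition can be solved for
      \<eta>.\<close>
    have "?\<alpha> \<noteq> 0"
      using not_cosp H_cospectral_of_phase_eq[OF lab std_mixed_cycle_labelled[OF assms(3), of 0], of \<eta>]
        total_phase_std_mixed_cycle[OF assms(3), of 0 \<eta>] by auto
    then have m0: "m \<noteq> 0" using m by auto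
    obtain \<tau> where "0 < \<tau>" "n dvd \<tau>" "cis (real (\<tau> div n) * ?\<alpha>) = 1"
      using per unfolding qw_periodic_def ret by blast
    then obtain N :: int where N: "real (\<tau> div n) * (of_int m * \<eta>) = of_int N * (2 * pi)"
      unfolding cis_eq_1_iff m by blast
    have "0 < \<tau> div n"
      using \<open>0 < \<tau>\<close> \<open>n dvd \<tau>\<close> n_pos by (simp add: div_greater_zero_iff dvd_imp_le)
    then have "\<eta> = of_int (2 * N) / of_int (int (\<tau> div n) * m) * pi"
      using N m0 by (simp add: field_simps)
    moreover have "of_int (2 * N) / of_int (int (\<tau> div n) * m) \<in> (\<rat> :: real set)"
      by (intro Rats_divide Rats_of_int)
    ultimately show ?thesis unfolding rat_mult_pi_def by blast
  qed
  have period: "qw_period G \<theta> = (if odd p then 2 * q * n div gcd j (2 * q) else q * n div gcd j q)"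
    if j: "j \<le> n" and cosp: "H_cospectral \<eta> G (std_mixed_cycle n j)"
      and q: "1 \<le> q" and cop: "coprime p q" and \<eta>: "\<eta> = real p / real q * pi" for j p q :: nat
  proof -
    \<comment> \<open>The multiplicative order of \<open>cis ?\<alpha>\<close>, as shown below; the
      period is \<open>n\<close> times it.\<close>
    define c where "c = (if odd p then 2 * q div gcd j (2 * q) else q div gcd j q)"
    have c_pos: "0 < c"
      using q by (auto simp: c_def div_greater_zero_iff intro!: gcd_le2_nat)
    have phase: "cis ?\<alpha> = cis (real j * \<eta>) \<or> cis (- ?\<alpha>) = cis (real j * \<eta>)"
      using H_cospectral_imp_phase[OF lab std_mixed_cycle_labelled[OF assms(3) j] cosp]
      by (simp only: total_phase_std_mixed_cycle[OF assms(3) j])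
    have "cis (real r * ?\<alpha>) = 1 \<longleftrightarrow> c dvd r" for r
    proof -
      have "cis (real r * ?\<alpha>) = 1 \<longleftrightarrow> cis (real (r * j) * (real p / real q * pi)) = 1"
        using cis_mult_nat_eq_1_cong[OF phase, of r]
        by (simp only: \<eta>[symmetric] of_nat_mult mult.assoc)
      also have "\<dots> \<longleftrightarrow> 2 * q dvd r * j * p"
        using q by (intro cis_pi_multiple_eq_1_iff) simp
      also have "\<dots> \<longleftrightarrow> c dvd r"
        unfolding c_def using q cop by (intro two_q_dvd_iff) auto
      finally show ?thesis .
    qed
    then have "qw_period G \<theta> = n * c"
      unfolding qw_period_def ret by (simp only: Least_multiple[OF n_pos c_pos])
    also have "\<dots> = (if odd p then 2 * q * n div gcd j (2 * q) else q * n div gcd j q)"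
      unfolding c_def by (simp add: div_mult_swap mult.commute)
    finally show ?thesis .
  qed
  show ?thesis using periodic rational period by blast
qed

end
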